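(* Let $j$ be the imaginary unit ($j^2=-1$), let $\mathbf{I}$ be the $2\times 2$ identity matrix, and let $$\mathbf{\Phi} = \begin{pmatrix} 0 & j \\ j & 0 \end{pmatrix}.$$ Then for every integer $m$, $$e^{2m\pi \mathbf{\Phi}} = \mathbf{I}.$$
   Context: For a square complex matrix $\mathbf{A}$, the matrix exponential is $e^{\mathbf{A}} = \sum_{n=0}^{+\infty} \frac{\mathbf{A}^n}{n!}$. The matrix $\mathbf{\Phi}$ here is the case $\alpha=1$ of the matrix $\begin{pmatrix} 0 & j \\ j\alpha^2 & 0 \end{pmatrix}$ ($\alpha$ a nonzero real number), called the imaginary unit matrix. *)

theory Defs
  imports "HOL-Analysis.Analysis"
begin

text \<open>
  On \<open>complex^'n^'n\<close> the library's \<open>*\<close> and \<open>^\<close> are entrywise and \<open>exp\<close> is not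
  available, so matrix powers and the exponential series are built here from the matrix
  product \<open>**\<close>; the series is taken in the norm topology of \<open>complex^'n^'n\<close>.
\<close>

primrec matrix_pow :: "complex^'n^'n \<Rightarrow> nat \<Rightarrow> complex^'n^'n" where
  "matrix_pow A 0 = mat 1"
| "matrix_pow A (Suc n) = A ** matrix_pow A n"

definition matrix_exp :: "complex^'n^'n \<Rightarrow> complex^'n^'n" where
  "matrix_exp A = (\<Sum>n. (1 / fact n) *\<^sub>R matrix_pow A n)"

definition imaginary_unit_matrix :: "real \<Rightarrow> complex^2^2" where
  "imaginary_unit_matrix \<alpha> =
     vector [vector [0, \<i>], vector [\<i> * (complex_of_real \<alpha>)\<^sup>2, 0]]"

definition Phi :: "complex^2^2" where
  "Phi = vector [vector [0, \<i>], vector [\<i>, 0]]"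

lemma Phi_eq_imaginary_unit_matrix: "Phi = imaginary_unit_matrix 1"
  by (simp add: Phi_def imaginary_unit_matrix_def)

lemma matrix_pow_entry_bound:
  fixes A :: "complex^'n^'n"
  assumes B: "\<And>i j. norm (A $ i $ j) \<le> B"
  shows "norm (matrix_pow A n $ i $ j) \<le> (real CARD('n) * B) ^ n"
proof (induction n arbitrary: i j)
  case 0
  show ?case by (simp add: mat_def)
next
  case (Suc n)
  have B0: "0 \<le> B" using B[of i j] norm_ge_zero order_trans by blast
  have "norm (matrix_pow A (Suc n) $ i $ j)
        \<le> (\<Sum>k\<in>UNIV. norm (A $ i $ k * matrix_pow A n $ k $ j))"
    by (simp add: matrix_matrix_mult_def norm_sum)
  also have "\<dots> \<le> (\<Sum>k\<in>(UNIV::'n set). B * (real CARD('n) * B) ^ n)"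
    unfolding norm_mult by (intro sum_mono mult_mono B Suc.IH B0) auto
  also have "\<dots> = (real CARD('n) * B) ^ Suc n" by simp
  finally show ?case .
qed

text \<open>The exponential series converges for every matrix, so \<open>suminf\<close> is its genuine sum.\<close>

lemma summable_matrix_exp:
  fixes A :: "complex^'n^'n"
  shows "summable (\<lambda>n. (1 / fact n) *\<^sub>R matrix_pow A n)"
proof -
  let ?N = "real CARD('n)"
  have B: "norm (A $ i $ j) \<le> norm A" for i j
    by (meson Finite_Cartesian_Product.norm_nth_le order_trans)
  have bd: "norm (matrix_pow A n) \<le> ?N * ?N * (?N * norm A) ^ n" for n
  proof -
    have "norm (matrix_pow A n) \<le> (\<Sum>i\<in>UNIV. norm (matrix_pow A n $ i))"
      unfolding norm_vec_def by (rule L2_set_le_sum) simp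
    also have "\<dots> \<le> (\<Sum>i\<in>UNIV. \<Sum>j\<in>UNIV. norm (matrix_pow A n $ i $ j))"
      unfolding norm_vec_def by (intro sum_mono L2_set_le_sum) simp
    also have "\<dots> \<le> (\<Sum>i\<in>(UNIV::'n set). \<Sum>j\<in>(UNIV::'n set). (?N * norm A) ^ n)"
      by (intro sum_mono matrix_pow_entry_bound B)
    finally show ?thesis by simp
  qed
  have S: "summable (\<lambda>n. ?N * ?N * (inverse (fact n) * (?N * norm A) ^ n))"
    by (intro summable_mult summable_exp)
  show ?thesis
  proof (rule summable_comparison_test'[OF S, of 0])
    fix n :: nat
    have "norm ((1 / fact n) *\<^sub>R matrix_pow A n) = inverse (fact n) * norm (matrix_pow A n)"
      by (simp add: divide_inverse)
    also have "\<dots> \<le> inverse (fact n) * (?N * ?N * (?N * norm A) ^ n)"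
      by (intro mult_left_mono bd) simp
    finally show "norm ((1 / fact n) *\<^sub>R matrix_pow A n)
        \<le> ?N * ?N * (inverse (fact n) * (?N * norm A) ^ n)"
      by (simp add: mult_ac)
  qed
qed

end

theory Submission
  imports Defs
begin

text \<open>
  The vectors \<open>(1, 1)\<close> and \<open>(1, -1)\<close> diagonalise \<open>Phi\<close>, with eigenvalues \<open>\<i>\<close> and \<open>-\<i>\<close>.
  Hence every entry of \<open>(x Phi)\<^sup>n\<close> is a fixed combination of \<open>(\<i> x)\<^sup>n\<close> and \<open>(-\<i> x)\<^sup>n\<close>
  (lemma \<open>matrix_pow_scaled_Phi\<close>), and summing the exponential series entry by entry gives
  Euler's formula \<open>exp (x Phi) = cos x I + sin x Phi\<close> (lemma \<open>matrix_exp_scaled_Phi\<close>). At a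
  multiple of \<open>2 * pi\<close> the cosine is 1 and the sine vanishes, leaving the identity.
\<close>

text \<open>
  This is the spectral decomposition \<open>z\<^sup>n P + (-z)\<^sup>n Q\<close> with \<open>z = \<i> x\<close>, read off entrywise:
  the spectral projections \<open>P\<close> and \<open>Q\<close> have all entries \<open>1/2\<close>, except for \<open>-1/2\<close> off the
  diagonal of \<open>Q\<close>.
\<close>

lemma matrix_pow_scaled_Phi:
  fixes x :: real
  defines "z \<equiv> \<i> * complex_of_real x"
  shows "matrix_pow (x *\<^sub>R Phi) n $ i $ j = (z ^ n + (if i = j then 1 else -1) * (-z) ^ n) / 2"
proof (induction n arbitrary: i j)
  case 0
  show ?case by (simp add: mat_def)
next
  case (Suc n)
  have entries: "(x *\<^sub>R Phi) $ 1 $ 1 = 0" "(x *\<^sub>R Phi) $ 1 $ 2 = z"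
      "(x *\<^sub>R Phi) $ 2 $ 1 = z" "(x *\<^sub>R Phi) $ 2 $ 2 = 0"
    by (simp_all add: Phi_def z_def scaleR_conv_of_real[where 'a = complex] mult.commute)
  show ?case
    using exhaust_2[of i] exhaust_2[of j]
    by (auto simp del: vector_scaleR_component
        simp add: matrix_matrix_mult_def sum_2 entries Suc.IH field_simps)
qed

text \<open>
  Entries are continuous linear functions of a matrix, so the two eigenvalue parts of the
  series become scalar exponential series.
\<close>

lemma matrix_exp_scaled_Phi:
  fixes x :: real
  shows "matrix_exp (x *\<^sub>R Phi) = cos x *\<^sub>R mat 1 + sin x *\<^sub>R Phi"
proof -
  define z where "z = \<i> * complex_of_real x"
  have entry: "matrix_exp (x *\<^sub>R Phi) $ i $ j
      = (exp z + (if i = j then 1 else -1) * exp (-z)) / 2" for i j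
  proof -
    let ?s = "if i = j then 1 else -1 :: complex"
    have "(\<lambda>n. (1 / fact n) *\<^sub>R matrix_pow (x *\<^sub>R Phi) n) sums matrix_exp (x *\<^sub>R Phi)"
      unfolding matrix_exp_def by (intro summable_sums summable_matrix_exp)
    then have "(\<lambda>n. ((1 / fact n) *\<^sub>R matrix_pow (x *\<^sub>R Phi) n) $ i $ j)
        sums (matrix_exp (x *\<^sub>R Phi) $ i $ j)"
      by (intro bounded_linear.sums[OF bounded_linear_vec_nth])
    moreover have "(\<lambda>n. (z ^ n /\<^sub>R fact n + ?s * ((-z) ^ n /\<^sub>R fact n)) / 2)
        sums ((exp z + ?s * exp (-z)) / 2)"
      by (intro sums_divide sums_add sums_mult exp_converges)
    moreover have "((1 / fact n) *\<^sub>R matrix_pow (x *\<^sub>R Phi) n) $ i $ j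
        = (z ^ n /\<^sub>R fact n + ?s * ((-z) ^ n /\<^sub>R fact n)) / 2" for n
      by (simp add: matrix_pow_scaled_Phi z_def[symmetric] scaleR_conv_of_real[where 'a = complex] field_simps)
    ultimately show ?thesis
      by (simp only: sums_unique2)
  qed
  have euler: "exp z = cos x + \<i> * sin x" "exp (-z) = cos x - \<i> * sin x"
    using exp_Euler[of "of_real x"] exp_Euler[of "- of_real x"]
    by (simp_all add: z_def cos_of_real sin_of_real)
  show ?thesis
    by (simp add: vec_eq_iff forall_2 entry euler)
      (simp add: Phi_def mat_def scaleR_conv_of_real)
qed

theorem mainTheorem2:
  fixes m :: int
  shows "matrix_exp ((2 * real_of_int m * pi) *\<^sub>R Phi) = mat 1"
proof -
  have "cos (2 * real_of_int m * pi) = 1" "sin (2 * real_of_int m * pi) = 0"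
    using cos_int_2pin[of m] sin_int_2pin[of m] by (simp_all add: mult_ac)
  then show ?thesis
    by (simp add: matrix_exp_scaled_Phi)
qed

end
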